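(* Let $G$ be a locally compact Hausdorff group with right Haar measure $\mu$, let $K$ be a Borel measurable subsemigroup of $G$ which is abelian (i.e. $gh=hg$ for all $g,h\in K$), and let $\mathfrak{H}$ be a complex Hilbert space. Let $U:K\rightarrow B(\mathfrak{H}):g\mapsto U_{g}$ be such that $\|U_{g}\|\leq 1$ and $U_{g}U_{h}=U_{gh}$ for all $g,h\in K$, and such that $K\ni g\mapsto\langle U_{g}x,y\rangle$ is Borel measurable for all $x,y\in\mathfrak{H}$. Let $P$ be the orthogonal projection of $\mathfrak{H}$ onto the closed subspace $V:=\{x\in\mathfrak{H}:U_{g}x=x\text{ for all }g\in K\}$. Let $\{\Lambda_{\alpha}\}$ be a space-filling net in $K$. Then for any $x,y\in\mathfrak{H}$ and $\varepsilon>0$ there is an $\alpha_{0}$ such that $$\left|\frac{1}{\mu(\Lambda_{\alpha_{0}})}\int_{\Lambda_{\alpha_{0}}h}\langle x,U_{g}y\rangle\,d\mu(g)\right|>|\langle x,Py\rangle|-\varepsilon$$ for all $h\in K$. In particular, for every $h\in K$ there is a $g\in\Lambda_{\alpha_{0}}h$ such that $$|\langle x,U_{g}y\rangle|>|\langle x,Py\rangle|-\varepsilon.$$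
   Context: $B(\mathfrak{H})$ denotes the algebra of bounded linear operators on $\mathfrak{H}$; inner products are linear in the second slot. A subsemigroup of $G$ is a subset $K\subset G$ (with $K=G$ allowed) such that $gh\in K$ for all $g,h\in K$. A net $\{\Lambda_{\alpha}\}$ is a family of subsets of $G$ indexed by a directed set. A net $\{\Lambda_{\alpha}\}$ of Borel subsets of $G$ is called space-filling in $K$ if $\Lambda_{\alpha}\subset K$ and $\mu(\Lambda_{\alpha})<\infty$ for all $\alpha$, $\mu(\Lambda_{\alpha})>0$ for all $\alpha$ large enough (i.e. for all $\alpha\geq\alpha_{1}$, for some $\alpha_{1}$), and $$\lim_{\alpha}\frac{\mu(\Lambda_{\alpha}\Delta(\Lambda_{\alpha}g))}{\mu(\Lambda_{\alpha})}=0$$ for all $g\in K$, where $A\Delta B:=(A\cup B)\setminus(A\cap B)$ and $\Lambda g:=\{kg:k\in\Lambda\}$. Whenever $1/\mu(\Lambda_{\alpha_0})$ is written, it is understood that $\mu(\Lambda_{\alpha_0})>0$. *)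

theory Defs
  imports "HOL-Analysis.Analysis"
begin

class complex_vector = real_vector +
  fixes scaleC :: "complex \<Rightarrow> 'a \<Rightarrow> 'a" (infixr "*\<^sub>C" 75)
  assumes scaleC_add_right: "c *\<^sub>C (x + y) = c *\<^sub>C x + c *\<^sub>C y"
    and scaleC_add_left: "(c + d) *\<^sub>C x = c *\<^sub>C x + d *\<^sub>C x"
    and scaleC_scaleC: "c *\<^sub>C d *\<^sub>C x = (c * d) *\<^sub>C x"
    and scaleC_of_real: "complex_of_real r *\<^sub>C x = r *\<^sub>R x"

text \<open>The inner product is linear in the second argument. Norm, metric and topology are those
  of the underlying real normed space, tied to the inner product by \<open>norm_eq_sqrt_cinner\<close>.\<close>

class complex_inner = complex_vector + real_normed_vector +
  fixes cinner :: "'a \<Rightarrow> 'a \<Rightarrow> complex"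
  assumes cinner_commute: "cinner x y = cnj (cinner y x)"
    and cinner_add_right: "cinner x (y + z) = cinner x y + cinner x z"
    and cinner_scaleC_right: "cinner x (c *\<^sub>C y) = c * cinner x y"
    and cinner_ge_zero: "0 \<le> Re (cinner x x)"
    and cinner_eq_zero_iff: "cinner x x = 0 \<longleftrightarrow> x = 0"
    and norm_eq_sqrt_cinner: "norm x = sqrt (Re (cinner x x))"

class complex_hilbert = complex_inner + complete_space

definition bounded_clinear :: "('a::complex_inner \<Rightarrow> 'b::complex_inner) \<Rightarrow> bool" where
  "bounded_clinear T \<longleftrightarrow> bounded_linear T \<and> (\<forall>c x. T (c *\<^sub>C x) = c *\<^sub>C T x)"

definition orth_proj :: "'a::complex_inner set \<Rightarrow> 'a \<Rightarrow> 'a" where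
  "orth_proj V x = (THE p. p \<in> V \<and> (\<forall>v\<in>V. cinner v (x - p) = 0))"

text \<open>Groups are written additively, since the library's class of (not necessarily commutative)
  topological groups is \<^class>\<open>topological_group_add\<close>; so \<open>g + h\<close> is the product \<open>gh\<close>, and
  \<open>right_translate A h\<close> is \<open>Ah\<close>.\<close>

definition right_translate :: "'g::plus set \<Rightarrow> 'g \<Rightarrow> 'g set" where
  "right_translate A h = (\<lambda>k. k + h) ` A"

definition radon_measure :: "'a::topological_space measure \<Rightarrow> bool" where
  "radon_measure M \<longleftrightarrow>
     sets M = sets borel \<and>
     (\<forall>C. compact C \<longrightarrow> emeasure M C < \<infinity>) \<and>
     (\<forall>A\<in>sets borel. emeasure M A = (INF W\<in>{W. open W \<and> A \<subseteq> W}. emeasure M W)) \<and>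
     (\<forall>W. open W \<longrightarrow> emeasure M W = (SUP C\<in>{C. compact C \<and> C \<subseteq> W}. emeasure M C))"

definition right_haar_measure :: "'g::{topological_group_add, t2_space} measure \<Rightarrow> bool" where
  "right_haar_measure M \<longleftrightarrow>
     radon_measure M \<and> emeasure M UNIV \<noteq> 0 \<and>
     (\<forall>A\<in>sets borel. \<forall>g. emeasure M (right_translate A g) = emeasure M A)"

definition subsemigroup :: "'g::plus set \<Rightarrow> bool" where
  "subsemigroup K \<longleftrightarrow> (\<forall>g\<in>K. \<forall>h\<in>K. g + h \<in> K)"

definition directed_set :: "'i set \<Rightarrow> ('i \<Rightarrow> 'i \<Rightarrow> bool) \<Rightarrow> bool" where
  "directed_set I le \<longleftrightarrow>
     I \<noteq> {} \<and>
     (\<forall>a\<in>I. le a a) \<and>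
     (\<forall>a\<in>I. \<forall>b\<in>I. \<forall>c\<in>I. le a b \<longrightarrow> le b c \<longrightarrow> le a c) \<and>
     (\<forall>a\<in>I. \<forall>b\<in>I. \<exists>c\<in>I. le a c \<and> le b c)"

definition tails :: "'i set \<Rightarrow> ('i \<Rightarrow> 'i \<Rightarrow> bool) \<Rightarrow> 'i filter" where
  "tails I le = (INF a\<in>I. principal {b\<in>I. le a b})"

lemma eventually_tails:
  assumes "directed_set I le"
  shows "eventually Q (tails I le) \<longleftrightarrow> (\<exists>a\<in>I. \<forall>b\<in>I. le a b \<longrightarrow> Q b)"
proof -
  have "eventually Q (tails I le) \<longleftrightarrow> (\<exists>a\<in>I. eventually Q (principal {b\<in>I. le a b}))"
    unfolding tails_def
  proof (rule eventually_INF_base)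
    show "I \<noteq> {}"
      using assms by (simp add: directed_set_def)
    fix a b assume ab: "a \<in> I" "b \<in> I"
    then obtain c where "c \<in> I" "le a c" "le b c"
      using assms unfolding directed_set_def by blast
    with ab assms have "c \<in> I" "{d\<in>I. le c d} \<subseteq> {d\<in>I. le a d} \<inter> {d\<in>I. le b d}"
      unfolding directed_set_def by blast+
    then show "\<exists>x\<in>I. principal {d\<in>I. le x d}
        \<le> inf (principal {d\<in>I. le a d}) (principal {d\<in>I. le b d})"
      by auto
  qed
  then show ?thesis
    by (auto simp: eventually_principal)
qed

definition space_filling ::
  "'g::{topological_group_add, t2_space} measure \<Rightarrow> 'g set \<Rightarrow>
   'i set \<Rightarrow> ('i \<Rightarrow> 'i \<Rightarrow> bool) \<Rightarrow> ('i \<Rightarrow> 'g set) \<Rightarrow> bool" where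
  "space_filling M K I le \<Lambda> \<longleftrightarrow>
     (\<forall>\<alpha>\<in>I. \<Lambda> \<alpha> \<in> sets borel \<and> \<Lambda> \<alpha> \<subseteq> K \<and> emeasure M (\<Lambda> \<alpha>) < \<infinity>) \<and>
     (\<forall>\<^sub>F \<alpha> in tails I le. 0 < emeasure M (\<Lambda> \<alpha>)) \<and>
     (\<forall>g\<in>K. ((\<lambda>\<alpha>. measure M ((\<Lambda> \<alpha> \<union> right_translate (\<Lambda> \<alpha>) g) - (\<Lambda> \<alpha> \<inter> right_translate (\<Lambda> \<alpha>) g))
                  / measure M (\<Lambda> \<alpha>)) \<longlongrightarrow> 0) (tails I le))"

end

theory Submission
  imports Defs
begin

text \<open>For a fixed \<open>x\<close>, the vectors \<open>z\<close> whose averages of \<open>\<langle>x, U\<^sub>g z\<rangle>\<close> over \<open>\<Lambda>\<^sub>\<alpha>h\<close> tend to \<open>0\<close>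
  uniformly in \<open>h\<close> form a closed subspace \<open>N\<close>, which contains all coboundaries \<open>z - U\<^sub>k z\<close> by
  the space-filling property. A vector \<open>w\<close> orthogonal to all coboundaries satisfies
  \<open>\<langle>w, U\<^sub>k w\<rangle> = \<parallel>w\<parallel>\<^sup>2\<close>, and since \<open>U\<^sub>k\<close> is a contraction this forces \<open>U\<^sub>k w = w\<close>. So the component
  of \<open>y - Py\<close> orthogonal to \<open>N\<close> is both fixed and orthogonal to the fixed vectors, hence zero;
  thus \<open>y - Py\<close> lies in \<open>N\<close>, while the averages of \<open>\<langle>x, U\<^sub>g P y\<rangle>\<close> all equal \<open>\<langle>x, P y\<rangle>\<close>.\<close>

section \<open>Algebra of the complex inner product and the Cauchy-Schwarz inequality\<close>

lemma cinner_add_left: "cinner (x + y) z = cinner x z + cinner y z"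
  for x y z :: "'a::complex_inner"
  by (metis cinner_add_right cinner_commute complex_cnj_add)

lemma cinner_scaleC_left: "cinner (c *\<^sub>C x) z = cnj c * cinner x z"
  for x z :: "'a::complex_inner"
  by (metis cinner_commute cinner_scaleC_right complex_cnj_mult)

lemma cinner_scaleR_right: "cinner x (r *\<^sub>R y) = complex_of_real r * cinner x y"
  for x y :: "'a::complex_inner"
  by (metis cinner_scaleC_right scaleC_of_real)

lemma cinner_scaleR_left: "cinner (r *\<^sub>R x) y = complex_of_real r * cinner x y"
  for x y :: "'a::complex_inner"
  by (metis cinner_scaleC_left complex_cnj_complex_of_real scaleC_of_real)

lemma cinner_minus_right: "cinner x (- y) = - cinner x y"
  for x y :: "'a::complex_inner"
  using cinner_scaleR_right[of x "-1" y] by simp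

lemma cinner_minus_left: "cinner (- x) y = - cinner x y"
  for x y :: "'a::complex_inner"
  using cinner_scaleR_left[of "-1" x y] by simp

lemma cinner_diff_right: "cinner x (y - z) = cinner x y - cinner x z"
  for x y z :: "'a::complex_inner"
  using cinner_add_right[of x y "- z"] by (simp add: cinner_minus_right)

lemma cinner_diff_left: "cinner (x - y) z = cinner x z - cinner y z"
  for x y z :: "'a::complex_inner"
  using cinner_add_left[of x "- y" z] by (simp add: cinner_minus_left)

lemma Re_cinner_commute: "Re (cinner x y) = Re (cinner y x)"
  for x y :: "'a::complex_inner"
  using arg_cong[OF cinner_commute[of x y], of Re] by simp

lemma power2_norm_eq_cinner: "(norm x)\<^sup>2 = Re (cinner x x)"
  for x :: "'a::complex_inner"
  by (simp add: norm_eq_sqrt_cinner cinner_ge_zero)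

lemma power2_norm_add: "(norm (x + y))\<^sup>2 = (norm x)\<^sup>2 + (norm y)\<^sup>2 + 2 * Re (cinner x y)"
  for x y :: "'a::complex_inner"
  using Re_cinner_commute[of y x]
  by (simp add: power2_norm_eq_cinner cinner_add_left cinner_add_right)

lemma power2_norm_diff: "(norm (x - y))\<^sup>2 = (norm x)\<^sup>2 + (norm y)\<^sup>2 - 2 * Re (cinner x y)"
  for x y :: "'a::complex_inner"
  using Re_cinner_commute[of y x]
  by (simp add: power2_norm_eq_cinner cinner_diff_left cinner_diff_right)

lemma parallelogram_law: "(norm (x + y))\<^sup>2 + (norm (x - y))\<^sup>2 = 2 * (norm x)\<^sup>2 + 2 * (norm y)\<^sup>2"
  for x y :: "'a::complex_inner"
  by (simp add: power2_norm_add power2_norm_diff)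

lemma norm_scaleC: "norm (c *\<^sub>C x) = cmod c * norm x"
  for x :: "'a::complex_inner"
proof -
  have "cinner (c *\<^sub>C x) (c *\<^sub>C x) = complex_of_real ((cmod c)\<^sup>2) * cinner x x"
    unfolding complex_norm_square by (simp add: cinner_scaleC_left cinner_scaleC_right)
  then show ?thesis
    by (simp add: norm_eq_sqrt_cinner real_sqrt_mult)
qed

text \<open>Comes from expanding the squared norm of
  \<open>norm y *\<^sub>R x - norm x *\<^sub>R y\<close>. Scaling crosswise, instead of normalising,
  avoids divisions; for nonzero vectors the positive factor \<open>2 * (norm x * norm y)\<close>
  then cancels.\<close>

lemma Re_cinner_le: "Re (cinner x y) \<le> norm x * norm y"
  for x y :: "'a::complex_inner"
proof (cases "x = 0 \<or> y = 0")
  case True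
  then show ?thesis
    using cinner_scaleR_right[of x 0 y] cinner_scaleR_left[of 0 x y] by auto
next
  case False
  then have pos: "0 < 2 * (norm x * norm y)"
    by simp
  have "0 \<le> (norm (norm y *\<^sub>R x - norm x *\<^sub>R y))\<^sup>2"
    by simp
  also have "\<dots> = 2 * (norm x * norm y) * (norm x * norm y - Re (cinner x y))"
    unfolding power2_norm_diff
    by (simp add: cinner_scaleR_left cinner_scaleR_right algebra_simps power2_eq_square)
  finally have "0 \<le> norm x * norm y - Re (cinner x y)"
    using mult_pos_neg[OF pos] by (meson not_less)
  then show ?thesis
    by simp
qed

lemma cmod_cinner_le: "cmod (cinner x y) \<le> norm x * norm y"
  for x y :: "'a::complex_inner"
proof (cases "cinner x y = 0")
  case False
  \<comment> \<open>A scalar of modulus one that rotates \<open>cinner x y\<close> onto the positive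
    real axis, so that the bound for real parts applies to \<open>c *\<^sub>C y\<close>.\<close>
  define c where "c = cnj (cinner x y) / complex_of_real (cmod (cinner x y))"
  have "cinner x (c *\<^sub>C y) = complex_of_real ((cmod (cinner x y))\<^sup>2) / complex_of_real (cmod (cinner x y))"
    unfolding complex_norm_square by (simp add: c_def cinner_scaleC_right mult.commute)
  then have "Re (cinner x (c *\<^sub>C y)) = cmod (cinner x y)"
    by (simp add: power2_eq_square)
  moreover have "cmod c = 1"
    using False by (simp add: c_def norm_divide)
  ultimately show ?thesis
    using Re_cinner_le[of x "c *\<^sub>C y"] by (metis mult_1 norm_scaleC)
qed simp

section \<open>Nearest points, orthogonal projections and fixed vectors of contractions\<close>

lemma closed_subspace_nearest_point:
  fixes x :: "'a::complex_hilbert"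
  assumes S: "subspace S" "closed S"
  shows "\<exists>p\<in>S. \<forall>s\<in>S. norm (x - p) \<le> norm (x - s)"
proof -
  define d where "d = (INF s\<in>S. norm (x - s))"
  have ne: "S \<noteq> {}"
    using subspace_0[OF S(1)] by auto
  have bdd: "bdd_below ((\<lambda>s. norm (x - s)) ` S)"
    by (intro bdd_belowI[of _ 0]) auto
  have d_le: "d \<le> norm (x - s)" if "s \<in> S" for s
    unfolding d_def by (rule cINF_lower[OF bdd that])
  have d0: "0 \<le> d"
    unfolding d_def by (rule cINF_greatest[OF ne]) auto
  have "\<exists>s\<in>S. norm (x - s) < d + 1 / real (Suc n)" for n
    using cINF_less_iff[OF ne bdd, of "d + 1 / real (Suc n)"] by (simp add: d_def)
  then obtain s where sS: "\<And>n. s n \<in> S" and s: "\<And>n. norm (x - s n) < d + 1 / real (Suc n)"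
    by metis
  have conv: "(\<lambda>n. norm (x - s n)) \<longlonglongrightarrow> d"
  proof (rule tendsto_sandwich)
    show "\<forall>\<^sub>F n in sequentially. d \<le> norm (x - s n)"
      using d_le sS by simp
    show "\<forall>\<^sub>F n in sequentially. norm (x - s n) \<le> d + 1 / real (Suc n)"
      using s less_imp_le by (intro always_eventually) blast
    show "(\<lambda>n. d + 1 / real (Suc n)) \<longlonglongrightarrow> d"
      using tendsto_add[OF tendsto_const[of d] LIMSEQ_inverse_real_of_nat]
      by (simp add: inverse_eq_divide)
  qed simp
  have dist_s: "(norm (s m - s n))\<^sup>2 \<le> 2 * ((norm (x - s m))\<^sup>2 - d\<^sup>2) + 2 * ((norm (x - s n))\<^sup>2 - d\<^sup>2)"
    for m n
  proof -
    \<comment> \<open>The midpoint of two members of the minimising sequence stays in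
      \<open>S\<close>, hence is at distance at least \<open>d\<close> from \<open>x\<close>. The
      parallelogram law then bounds the distance of the two members by their excesses over
      \<open>d\<close>, which gives the Cauchy property.\<close>
    have "(1/2) *\<^sub>R (s m + s n) \<in> S"
      using S(1) sS by (intro subspace_scale subspace_add)
    from d_le[OF this] have "d\<^sup>2 \<le> (norm (x - (1/2) *\<^sub>R (s m + s n)))\<^sup>2"
      using d0 by (rule power_mono)
    also have "(x - s m) + (x - s n) = 2 *\<^sub>R (x - (1/2) *\<^sub>R (s m + s n))"
      by (simp add: algebra_simps scaleR_2)
    then have "(norm (x - (1/2) *\<^sub>R (s m + s n)))\<^sup>2 = (norm ((x - s m) + (x - s n)))\<^sup>2 / 4"
      by (simp add: power_mult_distrib)
    finally show ?thesis
      using parallelogram_law[of "x - s m" "x - s n"] by (simp add: norm_minus_commute)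
  qed
  have "Cauchy s"
  proof (rule metric_CauchyI)
    fix e :: real assume e: "0 < e"
    have "(\<lambda>n. (norm (x - s n))\<^sup>2 - d\<^sup>2) \<longlonglongrightarrow> d\<^sup>2 - d\<^sup>2"
      by (intro tendsto_intros conv)
    then have "eventually (\<lambda>n. (norm (x - s n))\<^sup>2 - d\<^sup>2 < e\<^sup>2 / 4) sequentially"
      using e by (intro order_tendstoD(2)) auto
    then obtain N where N: "\<And>n. n \<ge> N \<Longrightarrow> (norm (x - s n))\<^sup>2 - d\<^sup>2 < e\<^sup>2 / 4"
      by (auto simp: eventually_sequentially)
    have "dist (s m) (s n) < e" if "m \<ge> N" "n \<ge> N" for m n
    proof (rule power_less_imp_less_base)
      show "(dist (s m) (s n))\<^sup>2 < e\<^sup>2"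
        using dist_s[of m n] N[OF that(1)] N[OF that(2)] by (simp add: dist_norm)
    qed (use e in simp)
    then show "\<exists>M. \<forall>m\<ge>M. \<forall>n\<ge>M. dist (s m) (s n) < e"
      by blast
  qed
  then obtain p where p: "s \<longlonglongrightarrow> p"
    unfolding convergent_eq_Cauchy[symmetric] by blast
  have "p \<in> S"
    using closed_sequentially[OF S(2) sS p] .
  moreover have "norm (x - p) = d"
    by (rule LIMSEQ_unique[OF _ conv]) (intro tendsto_intros p)
  ultimately show ?thesis
    using d_le by auto
qed

text \<open>First variation at the nearest point: moving \<open>p\<close> along \<open>v\<close>
  cannot bring it closer to \<open>x\<close>. Here \<open>subspace\<close> means a real subspace, so
  only the real part of the inner product is controlled.\<close>

lemma closed_subspace_orthogonal_decomposition:
  fixes x :: "'a::complex_hilbert"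
  assumes S: "subspace S" "closed S"
  obtains p where "p \<in> S" "\<And>v. v \<in> S \<Longrightarrow> Re (cinner v (x - p)) = 0"
proof -
  obtain p where p: "p \<in> S" and min: "\<And>s. s \<in> S \<Longrightarrow> norm (x - p) \<le> norm (x - s)"
    using closed_subspace_nearest_point[OF S] by blast
  have "Re (cinner v (x - p)) = 0" if v: "v \<in> S" for v
  proof (cases "v = 0")
    case True
    then show ?thesis
      using cinner_scaleR_left[of 0 v] by simp
  next
    case False
    define r where "r = Re (cinner v (x - p))"
    \<comment> \<open>The minimiser of the quadratic polynomial giving the squared norm of
      \<open>(x - p) - t *\<^sub>R v\<close>.\<close>
    define t where "t = r / (norm v)\<^sup>2"
    have "p + t *\<^sub>R v \<in> S"
      using S(1) p v by (intro subspace_add subspace_scale)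
    from min[OF this] have "(norm (x - p))\<^sup>2 \<le> (norm ((x - p) - t *\<^sub>R v))\<^sup>2"
      by (simp add: diff_diff_eq power_mono)
    then have "2 * (t * r) \<le> t\<^sup>2 * (norm v)\<^sup>2"
      using Re_cinner_commute[of v "x - p"]
      by (simp add: power2_norm_diff cinner_scaleR_right r_def power_mult_distrib)
    moreover have "t * r = r\<^sup>2 / (norm v)\<^sup>2" "t\<^sup>2 * (norm v)\<^sup>2 = r\<^sup>2 / (norm v)\<^sup>2"
      using False by (simp_all add: t_def power2_eq_square)
    ultimately have "r\<^sup>2 / (norm v)\<^sup>2 \<le> 0"
      by simp
    then show ?thesis
      using False by (simp add: r_def[symmetric] divide_le_0_iff)
  qed
  then show ?thesis
    using that p by blast
qed

text \<open>Existence comes from the nearest point. Uniqueness, which the definite description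
  requires, holds because the difference of two candidates lies in \<open>V\<close> and is
  orthogonal to itself.\<close>

lemma orth_proj_props:
  fixes x :: "'a::complex_hilbert"
  assumes S: "subspace V" "closed V" and sc: "\<And>c v. v \<in> V \<Longrightarrow> c *\<^sub>C v \<in> V"
  shows "orth_proj V x \<in> V" "\<And>v. v \<in> V \<Longrightarrow> cinner v (x - orth_proj V x) = 0"
proof -
  obtain p where p: "p \<in> V" and re: "\<And>v. v \<in> V \<Longrightarrow> Re (cinner v (x - p)) = 0"
    using closed_subspace_orthogonal_decomposition[OF S] by blast
  \<comment> \<open>Testing against \<open>\<i> *\<^sub>C v\<close> turns the real part into the
    imaginary part; this is where closure under complex scalars enters.\<close>
  have orth: "cinner v (x - p) = 0" if "v \<in> V" for v
    using re[OF that] re[OF sc[OF that, of "\<i>"]]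
    by (intro complex_eqI) (simp_all add: cinner_scaleC_left)
  have "orth_proj V x \<in> V \<and> (\<forall>v\<in>V. cinner v (x - orth_proj V x) = 0)"
    unfolding orth_proj_def
  proof (rule theI[of _ p])
    show "p \<in> V \<and> (\<forall>v\<in>V. cinner v (x - p) = 0)"
      using p orth by blast
    fix q assume q: "q \<in> V \<and> (\<forall>v\<in>V. cinner v (x - q) = 0)"
    then have qp: "q - p \<in> V"
      using S(1) p by (blast intro: subspace_diff)
    then have "cinner (q - p) ((x - p) - (x - q)) = 0"
      unfolding cinner_diff_right[of _ "x - p"] using q orth by simp
    then show "q = p"
      by (simp add: cinner_eq_zero_iff)
  qed
  then show "orth_proj V x \<in> V" "\<And>v. v \<in> V \<Longrightarrow> cinner v (x - orth_proj V x) = 0"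
    by auto
qed

text \<open>The orthogonality says that the real part of \<open>cinner (T w) w\<close> equals
  \<open>(norm w)\<^sup>2\<close>. Expanding \<open>(norm (T w - w))\<^sup>2\<close> and using the
  contraction bound leaves at most 0.\<close>

lemma contraction_fixed_if_orthogonal:
  fixes w :: "'a::complex_inner"
  assumes "norm (T w) \<le> norm w" "Re (cinner (w - T w) w) = 0"
  shows "T w = w"
proof -
  have "Re (cinner (T w) w) = (norm w)\<^sup>2"
    using assms(2) by (simp add: cinner_diff_left power2_norm_eq_cinner)
  then have "(norm (T w - w))\<^sup>2 \<le> 0"
    using power_mono[OF assms(1) norm_ge_zero, of 2] by (simp add: power2_norm_diff)
  then show ?thesis
    by simp
qed

section \<open>Right translates and invariance of Haar measure\<close>

lemma right_translate_eq_vimage: "right_translate A g = (\<lambda>k. k + - g) -` A"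
  for g :: "'g::group_add"
proof (intro set_eqI iffI)
  fix k assume "k \<in> (\<lambda>k. k + - g) -` A"
  then have "(k + - g) + g \<in> right_translate A g"
    unfolding right_translate_def by (intro imageI) simp
  then show "k \<in> right_translate A g"
    by (simp add: add.assoc)
qed (auto simp: right_translate_def add.assoc)

lemma right_translate_add: "right_translate (right_translate A g) h = right_translate A (g + h)"
  for g :: "'g::group_add"
  by (simp add: right_translate_def image_image add.assoc)

lemma right_translate_sym_diff:
  "right_translate (sym_diff A B) g = sym_diff (right_translate A g) (right_translate B g)"
  for g :: "'g::group_add"
  by (auto simp: right_translate_eq_vimage)

lemma borel_measurable_right_translation:
  "(\<lambda>k. k + g) \<in> borel_measurable borel" for g :: "'g::{topological_group_add, t2_space}"
  by (intro borel_measurable_continuous_onI continuous_intros)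

lemma right_translate_borel:
  "A \<in> sets borel \<Longrightarrow> right_translate A g \<in> sets borel"
  for g :: "'g::{topological_group_add, t2_space}"
  unfolding right_translate_eq_vimage
  using measurable_sets[OF borel_measurable_right_translation[of "- g"]] by simp

lemma right_haar_measureD:
  assumes "right_haar_measure M"
  shows "sets M = sets borel" "A \<in> sets borel \<Longrightarrow> emeasure M (right_translate A g) = emeasure M A"
  using assms by (auto simp: right_haar_measure_def radon_measure_def)

lemma measure_right_translate:
  assumes "right_haar_measure M" "A \<in> sets borel"
  shows "measure M (right_translate A g) = measure M A"
  using right_haar_measureD(2)[OF assms] by (simp add: measure_def)

text \<open>The preimage of a set under translation by \<open>g\<close> is its right translate by
  \<open>- g\<close>. Invariance on sets thus becomes invariance of the image measure, the form
  suited to a change of variables.\<close>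

lemma distr_right_translation:
  assumes M: "right_haar_measure M"
  shows "distr M M (\<lambda>k. k + g) = M"
proof (rule measure_eqI)
  have [measurable]: "(\<lambda>k. k + g) \<in> measurable M M"
    using borel_measurable_right_translation right_haar_measureD(1)[OF M]
    by (metis measurable_cong_sets)
  fix A assume "A \<in> sets (distr M M (\<lambda>k. k + g))"
  then have A: "A \<in> sets M"
    by simp
  have "space M = UNIV"
    using sets_eq_imp_space_eq[OF right_haar_measureD(1)[OF M]] by simp
  then show "emeasure (distr M M (\<lambda>k. k + g)) A = emeasure M A"
    using A right_haar_measureD(1)[OF M] right_haar_measureD(2)[OF M, of A "- g"]
    by (simp add: emeasure_distr right_translate_eq_vimage)
qed simp

text \<open>Substitution of \<open>k + g\<close> for \<open>k\<close> in an integral against the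
  invariant measure; the indicator of the translate at \<open>k + g\<close> is the indicator of
  \<open>A\<close> at \<open>k\<close>.\<close>

lemma set_integral_right_translate:
  fixes f :: "'g::{topological_group_add, t2_space} \<Rightarrow> 'b::{banach, second_countable_topology}"
  assumes M: "right_haar_measure M"
    and f: "set_borel_measurable M (right_translate A g) f"
  shows "(LINT k:right_translate A g|M. f k) = (LINT k:A|M. f (k + g))"
proof -
  have [measurable]: "(\<lambda>k. k + g) \<in> measurable M M"
    using borel_measurable_right_translation right_haar_measureD(1)[OF M]
    by (metis measurable_cong_sets)
  have "(LINT k:right_translate A g|M. f k) = (LINT k:right_translate A g|distr M M (\<lambda>k. k + g). f k)"
    by (simp add: distr_right_translation[OF M])
  also have "\<dots> = (LINT k|M. indicator (right_translate A g) (k + g) *\<^sub>R f (k + g))"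
    unfolding set_lebesgue_integral_def
    using f by (intro integral_distr) (auto simp: set_borel_measurable_def)
  also have "\<dots> = (LINT k:A|M. f (k + g))"
    unfolding set_lebesgue_integral_def
    by (simp add: indicator_def right_translate_eq_vimage add.assoc)
  finally show ?thesis .
qed

section \<open>Bounds for integrals over sets of finite measure\<close>

lemma set_integrable_bounded:
  fixes f :: "'a \<Rightarrow> 'b::{banach, second_countable_topology}"
  assumes "set_borel_measurable M A f" "A \<in> sets M" "emeasure M A < \<infinity>"
    and "\<And>a. a \<in> A \<Longrightarrow> norm (f a) \<le> B"
  shows "set_integrable M A f"
  unfolding set_integrable_def
  by (rule integrableI_bounded_set[where A = A and B = B])
    (use assms in \<open>auto simp: set_borel_measurable_def\<close>)

text \<open>The two integrands cancel on the intersection, so only the symmetric difference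
  contributes. With \<open>B = {}\<close> this becomes the usual bound of an integral by a supremum
  times a measure.\<close>

lemma norm_set_integral_diff_le:
  fixes f :: "'a \<Rightarrow> 'b::{banach, second_countable_topology}"
  assumes f: "set_integrable M A f" "set_integrable M B f"
    and AB: "A \<in> sets M" "B \<in> sets M" "emeasure M A < \<infinity>" "emeasure M B < \<infinity>"
    and le: "\<And>a. a \<in> A \<union> B \<Longrightarrow> norm (f a) \<le> C"
  shows "norm ((LINT a:A|M. f a) - (LINT a:B|M. f a)) \<le> C * measure M (sym_diff A B)"
proof -
  have fin: "emeasure M (sym_diff A B) < \<infinity>"
  proof -
    have "emeasure M (sym_diff A B) \<le> emeasure M (A \<union> B)"
      using AB by (intro emeasure_mono) auto
    also have "\<dots> < \<infinity>"
      using emeasure_subadditive[OF AB(1,2)] AB(3,4)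
      by (metis ennreal_add_less_top infinity_ennreal_def le_less_trans)
    finally show ?thesis .
  qed
  let ?d = "\<lambda>a. indicator A a *\<^sub>R f a - indicator B a *\<^sub>R f a"
  have d: "integrable M ?d"
    using f unfolding set_integrable_def by (rule Bochner_Integration.integrable_diff)
  have "norm (LINT a|M. ?d a) \<le> (LINT a|M. norm (?d a))"
    by (rule integral_norm_bound)
  also have "\<dots> \<le> (LINT a|M. C * indicator (sym_diff A B) a)"
  proof (rule integral_mono)
    show "integrable M (\<lambda>a. C * indicator (sym_diff A B) a)"
      using AB fin by (intro integrable_mult_right integrable_real_indicator) auto
    show "integrable M (\<lambda>a. norm (?d a))"
      using d by (rule integrable_norm)
  qed (use le in \<open>auto simp: indicator_def\<close>)
  also have "\<dots> = C * measure M (sym_diff A B)"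
    using AB sets.sets_into_space by (simp add: Int_absorb2 subset_iff)
  finally show ?thesis
    using f by (simp add: set_lebesgue_integral_def set_integrable_def)
qed

section \<open>Integrals of matrix coefficients of a commuting contraction semigroup\<close>

locale contraction_semigroup =
  fixes M :: "'g::{topological_group_add, t2_space} measure"
    and K :: "'g set"
    and U :: "'g \<Rightarrow> 'h::complex_hilbert \<Rightarrow> 'h"
  assumes haar: "right_haar_measure M"
    and K_borel: "K \<in> sets borel"
    and K_add: "\<And>g h. g \<in> K \<Longrightarrow> h \<in> K \<Longrightarrow> g + h \<in> K"
    and K_commute: "\<And>g h. g \<in> K \<Longrightarrow> h \<in> K \<Longrightarrow> g + h = h + g"
    and U_clinear: "\<And>g. g \<in> K \<Longrightarrow> bounded_clinear (U g)"
    and U_onorm: "\<And>g. g \<in> K \<Longrightarrow> onorm (U g) \<le> 1"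
    and U_add_arg: "\<And>g h z. g \<in> K \<Longrightarrow> h \<in> K \<Longrightarrow> U (g + h) z = U g (U h z)"
    and U_measurable: "\<And>u v. (\<lambda>g. cinner (U g u) v) \<in> borel_measurable (restrict_space borel K)"
begin

lemma U_bounded_linear: "g \<in> K \<Longrightarrow> bounded_linear (U g)"
  using U_clinear by (simp add: bounded_clinear_def)

lemmas U_0 = bounded_linear.linear[OF U_bounded_linear, THEN linear_0]
  and U_add = bounded_linear.linear[OF U_bounded_linear, THEN linear_add]
  and U_diff = bounded_linear.linear[OF U_bounded_linear, THEN linear_diff]
  and U_scaleR = bounded_linear.linear[OF U_bounded_linear, THEN linear_scale]

lemma U_scaleC: "g \<in> K \<Longrightarrow> U g (c *\<^sub>C z) = c *\<^sub>C U g z"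
  using U_clinear by (simp add: bounded_clinear_def)

lemma norm_U_le:
  assumes "g \<in> K"
  shows "norm (U g z) \<le> norm z"
  using onorm[OF U_bounded_linear[OF assms], of z]
    mult_right_mono[OF U_onorm[OF assms] norm_ge_zero[of z]] by simp

lemma cmod_cinner_U_le: "g \<in> K \<Longrightarrow> cmod (cinner x (U g z)) \<le> norm x * norm z"
  using cmod_cinner_le[of x "U g z"] norm_U_le[of g z]
  by (meson mult_left_mono norm_ge_zero order_trans)

lemma right_translate_subset: "A \<subseteq> K \<Longrightarrow> h \<in> K \<Longrightarrow> right_translate A h \<subseteq> K"
  using K_add by (auto simp: right_translate_def)

text \<open>Measurability is assumed with the orbit in the first slot of the inner product, while
  the integrand has it in the second; complex conjugation passes from one to the other. The cut-off
  by \<open>indicator K\<close> extends the coefficient to the whole group and is invisible on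
  \<open>A\<close>.\<close>

lemma set_borel_measurable_U:
  assumes "A \<in> sets borel" "A \<subseteq> K"
  shows "set_borel_measurable M A (\<lambda>g. cinner x (U g z))"
proof -
  have "(\<lambda>g. indicator K g *\<^sub>R cinner (U g z) x) \<in> borel_measurable borel"
    using U_measurable K_borel by (simp add: borel_measurable_restrict_space_iff)
  then have "(\<lambda>g. cnj (indicator K g *\<^sub>R cinner (U g z) x)) \<in> borel_measurable borel"
    by (rule borel_measurable_continuous_on[OF continuous_on_cnj[OF continuous_on_id]])
  then have "(\<lambda>g. indicator A g *\<^sub>R cnj (indicator K g *\<^sub>R cinner (U g z) x)) \<in> borel_measurable borel"
    by (intro borel_measurable_scaleR borel_measurable_indicator assms(1))
  also have "(\<lambda>g. indicator A g *\<^sub>R cnj (indicator K g *\<^sub>R cinner (U g z) x)) =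
      (\<lambda>g. indicator A g *\<^sub>R cinner x (U g z))"
    using assms(2) cinner_commute[of x] by (auto simp: indicator_def fun_eq_iff)
  finally show ?thesis
    unfolding set_borel_measurable_def
    using right_haar_measureD(1)[OF haar] by (metis measurable_cong_sets)
qed

lemma set_integrable_U:
  assumes "A \<in> sets borel" "A \<subseteq> K" "emeasure M A < \<infinity>"
  shows "set_integrable M A (\<lambda>g. cinner x (U g z))"
  using assms right_haar_measureD(1)[OF haar]
  by (intro set_integrable_bounded[where B = "norm x * norm z"] set_borel_measurable_U
      cmod_cinner_U_le) auto

lemma cmod_set_integral_U_le:
  assumes "A \<in> sets borel" "A \<subseteq> K" "emeasure M A < \<infinity>"
  shows "cmod (LINT g:A|M. cinner x (U g z)) \<le> norm x * norm z * measure M A"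
  using norm_set_integral_diff_le[of M A "\<lambda>g. cinner x (U g z)" "{}" "norm x * norm z"]
    assms right_haar_measureD(1)[OF haar] set_integrable_U cmod_cinner_U_le
  by (auto simp: subset_iff set_lebesgue_integral_def)

lemma set_integral_U_add:
  assumes "A \<in> sets borel" "A \<subseteq> K" "emeasure M A < \<infinity>"
  shows "(LINT g:A|M. cinner x (U g (y + z))) =
    (LINT g:A|M. cinner x (U g y)) + (LINT g:A|M. cinner x (U g z))"
proof -
  have "(LINT g:A|M. cinner x (U g (y + z))) = (LINT g:A|M. cinner x (U g y) + cinner x (U g z))"
    unfolding set_lebesgue_integral_def using assms(2)
    by (intro Bochner_Integration.integral_cong)
      (auto simp: indicator_def U_add cinner_add_right subset_iff)
  then show ?thesis
    using set_integral_add(2)[OF set_integrable_U set_integrable_U, OF assms assms] by simp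
qed

lemma set_integral_U_scaleR:
  assumes "A \<subseteq> K"
  shows "(LINT g:A|M. cinner x (U g (c *\<^sub>R z))) = complex_of_real c * (LINT g:A|M. cinner x (U g z))"
proof -
  have "(LINT g:A|M. cinner x (U g (c *\<^sub>R z))) = (LINT g:A|M. complex_of_real c * cinner x (U g z))"
    unfolding set_lebesgue_integral_def using assms
    by (intro Bochner_Integration.integral_cong)
      (auto simp: indicator_def U_scaleR cinner_scaleR_right subset_iff)
  then show ?thesis
    by simp
qed

text \<open>By right invariance and commutativity the integral over \<open>Ah\<close> is a difference of integrals of
  one function over \<open>Ah\<close> and \<open>Akh\<close>, and \<open>(A \<triangle> Ak)h\<close> has the measure of \<open>A \<triangle> Ak\<close>. Hence the
  bound does not depend on \<open>h\<close>.\<close>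

lemma cmod_set_integral_coboundary_le:
  assumes A: "A \<in> sets borel" "A \<subseteq> K" "emeasure M A < \<infinity>" and hk: "h \<in> K" "k \<in> K"
  shows "cmod (LINT g:right_translate A h|M. cinner x (U g (z - U k z)))
    \<le> norm x * norm z * measure M (sym_diff A (right_translate A k))"
proof -
  let ?f = "\<lambda>g. cinner x (U g z)"
  let ?B = "right_translate A h" and ?C = "right_translate (right_translate A k) h"
  \<comment> \<open>The one place where commutativity of \<open>K\<close> enters. It exhibits the
    set as the translate of \<open>?B\<close> by \<open>k\<close>, so that substitution replaces
    \<open>z\<close> by \<open>U k z\<close> in the integrand.\<close>
  have C_eq: "?C = right_translate ?B k"
    using K_commute[OF hk] by (simp add: right_translate_add)
  have B: "?B \<in> sets borel" "?B \<subseteq> K" "emeasure M ?B < \<infinity>"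
    using A hk by (simp_all add: right_translate_borel right_translate_subset
        right_haar_measureD(2)[OF haar])
  have C: "?C \<in> sets borel" "?C \<subseteq> K" "emeasure M ?C < \<infinity>"
    unfolding C_eq using B hk by (simp_all add: right_translate_borel right_translate_subset
        right_haar_measureD(2)[OF haar])
  have shift: "?f (g + k) = cinner x (U g (U k z))" if "g \<in> ?B" for g
    using U_add_arg hk B(2) that by auto
  have "(LINT g:?C|M. ?f g) = (LINT g:?B|M. ?f (g + k))"
    unfolding C_eq using C
    by (intro set_integral_right_translate[OF haar] set_borel_measurable_U) (simp_all add: C_eq)
  also have "\<dots> = (LINT g:?B|M. cinner x (U g (U k z)))"
    unfolding set_lebesgue_integral_def
    by (intro Bochner_Integration.integral_cong) (auto simp: indicator_def shift)
  finally have "(LINT g:?B|M. ?f g) - (LINT g:?C|M. ?f g) =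
      (LINT g:?B|M. ?f g - cinner x (U g (U k z)))"
    using set_integral_diff(2)[OF set_integrable_U set_integrable_U, OF B B] by simp
  also have "\<dots> = (LINT g:?B|M. cinner x (U g (z - U k z)))"
    unfolding set_lebesgue_integral_def using B(2)
    by (intro Bochner_Integration.integral_cong)
      (auto simp: indicator_def U_diff cinner_diff_right subset_iff)
  finally have eq: "(LINT g:?B|M. cinner x (U g (z - U k z))) =
      (LINT g:?B|M. ?f g) - (LINT g:?C|M. ?f g)" ..
  have "cmod (LINT g:?B|M. cinner x (U g (z - U k z))) \<le> norm x * norm z * measure M (sym_diff ?B ?C)"
    unfolding eq using B C cmod_cinner_U_le right_haar_measureD(1)[OF haar]
    by (intro norm_set_integral_diff_le set_integrable_U) auto
  also have "measure M (sym_diff ?B ?C) = measure M (sym_diff A (right_translate A k))"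
    unfolding right_translate_sym_diff[symmetric] using A(1)
    by (intro measure_right_translate[OF haar] sets.Un sets.Diff right_translate_borel)
  finally show ?thesis .
qed

definition fixed_space :: "'h set" where
  "fixed_space = {v. \<forall>g\<in>K. U g v = v}"

lemma subspace_fixed_space: "subspace fixed_space"
  by (rule subspaceI)
    (simp_all add: fixed_space_def U_0 U_add U_scaleR)

lemma closed_fixed_space: "closed fixed_space"
proof -
  have "fixed_space = (\<Inter>g\<in>K. {v. U g v = v})"
    by (auto simp: fixed_space_def)
  also have "closed \<dots>"
  proof (intro closed_INT ballI)
    fix g assume "g \<in> K"
    then have "continuous_on UNIV (U g)"
      by (rule linear_continuous_on[OF U_bounded_linear])
    then show "closed {v. U g v = v}"
      by (rule closed_Collect_eq) (rule continuous_on_id)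
  qed
  finally show ?thesis .
qed

lemma scaleC_fixed_space: "v \<in> fixed_space \<Longrightarrow> c *\<^sub>C v \<in> fixed_space"
  by (simp add: fixed_space_def U_scaleC)

lemma set_integral_fixed:
  assumes "A \<subseteq> K" "v \<in> fixed_space"
  shows "(LINT g:A|M. cinner x (U g v)) = complex_of_real (measure M A) * cinner x v"
proof -
  have "(LINT g:A|M. cinner x (U g v)) = (LINT g|M. indicator A g *\<^sub>R cinner x v)"
    unfolding set_lebesgue_integral_def using assms
    by (intro Bochner_Integration.integral_cong) (auto simp: indicator_def fixed_space_def)
  then show ?thesis
    using right_haar_measureD(1)[OF haar] sets_eq_imp_space_eq[of M borel]
    by (simp add: scaleR_conv_of_real)
qed

end

section \<open>Uniformly vanishing averages along the net\<close>

locale contraction_semigroup_net = contraction_semigroup M K U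
  for M :: "'g::{topological_group_add, t2_space} measure" and K
    and U :: "'g \<Rightarrow> 'h::complex_hilbert \<Rightarrow> 'h" +
  fixes F :: "'i filter" and \<Lambda> :: "'i \<Rightarrow> 'g set"
  assumes ev_sets: "\<forall>\<^sub>F \<alpha> in F. \<Lambda> \<alpha> \<in> sets borel \<and> \<Lambda> \<alpha> \<subseteq> K \<and> emeasure M (\<Lambda> \<alpha>) < \<infinity>"
    and ev_pos: "\<forall>\<^sub>F \<alpha> in F. 0 < emeasure M (\<Lambda> \<alpha>)"
    and ratio_tendsto: "\<And>g. g \<in> K \<Longrightarrow>
      ((\<lambda>\<alpha>. measure M (sym_diff (\<Lambda> \<alpha>) (right_translate (\<Lambda> \<alpha>) g)) / measure M (\<Lambda> \<alpha>)) \<longlongrightarrow> 0) F"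
begin

text \<open>The net is seen only through the filter \<open>F\<close>. This predicate bundles the
  conditions on an index that hold eventually and make its averages meaningful.\<close>

definition good :: "'i \<Rightarrow> bool" where
  "good \<alpha> \<longleftrightarrow> \<Lambda> \<alpha> \<in> sets borel \<and> \<Lambda> \<alpha> \<subseteq> K \<and> emeasure M (\<Lambda> \<alpha>) < \<infinity> \<and> 0 < emeasure M (\<Lambda> \<alpha>)"

lemma eventually_good: "eventually good F"
  using eventually_conj[OF ev_sets ev_pos] by (simp add: good_def[abs_def])

lemma measure_good: "good \<alpha> \<Longrightarrow> 0 < measure M (\<Lambda> \<alpha>)"
  by (simp add: good_def measure_def enn2real_positive_iff)

lemma good_translate:
  assumes "good \<alpha>" "h \<in> K"
  shows "right_translate (\<Lambda> \<alpha>) h \<in> sets borel" "right_translate (\<Lambda> \<alpha>) h \<subseteq> K"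
    "emeasure M (right_translate (\<Lambda> \<alpha>) h) < \<infinity>"
    "measure M (right_translate (\<Lambda> \<alpha>) h) = measure M (\<Lambda> \<alpha>)"
  using assms by (simp_all add: good_def right_translate_borel right_translate_subset
      right_haar_measureD(2)[OF haar] measure_right_translate[OF haar])

text \<open>The subspace N of the overview. Denominators are cleared, and by invariance the measure
  of \<open>\<Lambda> \<alpha>\<close> is also that of its translates. The quantifier over
  \<open>h\<close> stands inside the eventual statement, which makes the convergence uniform in
  \<open>h\<close>.\<close>

definition null_average :: "'h \<Rightarrow> 'h set" where
  "null_average x = {z. \<forall>\<eta>>0. \<forall>\<^sub>F \<alpha> in F. good \<alpha> \<and> (\<forall>h\<in>K.
     cmod (LINT g:right_translate (\<Lambda> \<alpha>) h|M. cinner x (U g z)) \<le> \<eta> * measure M (\<Lambda> \<alpha>))}"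

text \<open>The bound on coboundary integrals does not involve \<open>h\<close>; divided by the
  measure of \<open>\<Lambda> \<alpha>\<close>, it is a constant times the space-filling
  ratio.\<close>

lemma coboundary_null_average:
  assumes k: "k \<in> K"
  shows "z - U k z \<in> null_average x"
  unfolding null_average_def
proof (intro CollectI allI impI)
  fix \<eta> :: real assume \<eta>: "0 < \<eta>"
  let ?r = "\<lambda>\<alpha>. measure M (sym_diff (\<Lambda> \<alpha>) (right_translate (\<Lambda> \<alpha>) k)) / measure M (\<Lambda> \<alpha>)"
  have "((\<lambda>\<alpha>. norm x * norm z * ?r \<alpha>) \<longlongrightarrow> norm x * norm z * 0) F"
    by (intro tendsto_intros ratio_tendsto k)
  then have "\<forall>\<^sub>F \<alpha> in F. norm x * norm z * ?r \<alpha> < \<eta>"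
    using \<eta> by (auto intro: order_tendstoD)
  with eventually_good show "\<forall>\<^sub>F \<alpha> in F. good \<alpha> \<and> (\<forall>h\<in>K.
     cmod (LINT g:right_translate (\<Lambda> \<alpha>) h|M. cinner x (U g (z - U k z))) \<le> \<eta> * measure M (\<Lambda> \<alpha>))"
  proof eventually_elim
    case (elim \<alpha>)
    have "norm x * norm z * measure M (sym_diff (\<Lambda> \<alpha>) (right_translate (\<Lambda> \<alpha>) k))
        \<le> \<eta> * measure M (\<Lambda> \<alpha>)"
      using elim(2) measure_good[OF elim(1)] by (simp add: pos_divide_less_eq)
    then show ?case
      using elim(1) cmod_set_integral_coboundary_le[OF _ _ _ _ k, of "\<Lambda> \<alpha>"]
      by (auto simp: good_def intro: order_trans)
  qed
qed

lemma subspace_null_average: "subspace (null_average x)"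
proof (rule subspaceI)
  show "0 \<in> null_average x"
    unfolding null_average_def
  proof (intro CollectI allI impI eventually_mono[OF eventually_good] conjI ballI)
    fix \<eta> :: real and \<alpha> h assume "0 < \<eta>" "good \<alpha>" "h \<in> K"
    then show "cmod (LINT g:right_translate (\<Lambda> \<alpha>) h|M. cinner x (U g 0)) \<le> \<eta> * measure M (\<Lambda> \<alpha>)"
      using cmod_set_integral_U_le[OF good_translate(1-3), of \<alpha> h x 0] by (simp add: order_trans)
  qed
next
  fix y z assume yz: "y \<in> null_average x" "z \<in> null_average x"
  show "y + z \<in> null_average x"
    unfolding null_average_def
  proof (intro CollectI allI impI)
    fix \<eta> :: real assume "0 < \<eta>"
    then have "0 < \<eta> / 2"
      by simp
    with yz have "\<forall>\<^sub>F \<alpha> in F. good \<alpha> \<and> (\<forall>h\<in>K.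
        cmod (LINT g:right_translate (\<Lambda> \<alpha>) h|M. cinner x (U g y)) \<le> \<eta> / 2 * measure M (\<Lambda> \<alpha>))"
      "\<forall>\<^sub>F \<alpha> in F. good \<alpha> \<and> (\<forall>h\<in>K.
        cmod (LINT g:right_translate (\<Lambda> \<alpha>) h|M. cinner x (U g z)) \<le> \<eta> / 2 * measure M (\<Lambda> \<alpha>))"
      unfolding null_average_def by blast+
    then show "\<forall>\<^sub>F \<alpha> in F. good \<alpha> \<and> (\<forall>h\<in>K.
        cmod (LINT g:right_translate (\<Lambda> \<alpha>) h|M. cinner x (U g (y + z))) \<le> \<eta> * measure M (\<Lambda> \<alpha>))"
    proof eventually_elim
      case (elim \<alpha>)
      show ?case
      proof (intro conjI ballI)
        fix h assume h: "h \<in> K"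
        show "cmod (LINT g:right_translate (\<Lambda> \<alpha>) h|M. cinner x (U g (y + z))) \<le> \<eta> * measure M (\<Lambda> \<alpha>)"
          unfolding set_integral_U_add[OF good_translate(1-3)[OF conjunct1[OF elim(1)] h]]
          by (rule order_trans[OF norm_triangle_mono[OF elim(1)[THEN conjunct2, rule_format, OF h]
                elim(2)[THEN conjunct2, rule_format, OF h]]]) simp
      qed (use elim in blast)
    qed
  qed
next
  fix c :: real and z assume z: "z \<in> null_average x"
  show "c *\<^sub>R z \<in> null_average x"
    unfolding null_average_def
  proof (intro CollectI allI impI)
    fix \<eta> :: real assume \<eta>: "0 < \<eta>"
    \<comment> \<open>Adding 1 keeps the denominator positive when \<open>c = 0\<close>, and the
      resulting factor \<open>\<bar>c\<bar> / (\<bar>c\<bar> + 1)\<close> is still at most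
      1.\<close>
    then have "0 < \<eta> / (\<bar>c\<bar> + 1)"
      by simp
    with z have "\<forall>\<^sub>F \<alpha> in F. good \<alpha> \<and> (\<forall>h\<in>K.
        cmod (LINT g:right_translate (\<Lambda> \<alpha>) h|M. cinner x (U g z)) \<le> \<eta> / (\<bar>c\<bar> + 1) * measure M (\<Lambda> \<alpha>))"
      unfolding null_average_def by blast
    then show "\<forall>\<^sub>F \<alpha> in F. good \<alpha> \<and> (\<forall>h\<in>K.
        cmod (LINT g:right_translate (\<Lambda> \<alpha>) h|M. cinner x (U g (c *\<^sub>R z))) \<le> \<eta> * measure M (\<Lambda> \<alpha>))"
    proof eventually_elim
      case (elim \<alpha>)
      show ?case
      proof (intro conjI ballI)
        fix h assume h: "h \<in> K"
        have "cmod (LINT g:right_translate (\<Lambda> \<alpha>) h|M. cinner x (U g (c *\<^sub>R z)))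
            = \<bar>c\<bar> * cmod (LINT g:right_translate (\<Lambda> \<alpha>) h|M. cinner x (U g z))"
          using good_translate(2) elim h by (simp add: set_integral_U_scaleR norm_mult)
        also have "\<dots> \<le> \<bar>c\<bar> * (\<eta> / (\<bar>c\<bar> + 1) * measure M (\<Lambda> \<alpha>))"
          using elim h by (intro mult_left_mono) auto
        also have "\<dots> = (\<bar>c\<bar> / (\<bar>c\<bar> + 1)) * (\<eta> * measure M (\<Lambda> \<alpha>))"
          by simp
        also have "\<dots> \<le> 1 * (\<eta> * measure M (\<Lambda> \<alpha>))"
          using \<eta> by (intro mult_right_mono) auto
        finally show "cmod (LINT g:right_translate (\<Lambda> \<alpha>) h|M. cinner x (U g (c *\<^sub>R z)))
            \<le> \<eta> * measure M (\<Lambda> \<alpha>)"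
          by simp
      qed (use elim in blast)
    qed
  qed
qed

text \<open>Because each \<open>U g\<close> is a contraction, replacing \<open>z\<close> by a nearby
  \<open>y\<close> changes the average over any translate by at most
  \<open>norm x * norm (z - y)\<close>, uniformly in the good index and in \<open>h\<close>.\<close>

lemma closed_null_average: "closed (null_average x)"
proof -
  have "z \<in> null_average x" if z: "z \<in> closure (null_average x)" for z
    unfolding null_average_def
  proof (intro CollectI allI impI)
    fix \<eta> :: real assume \<eta>: "0 < \<eta>"
    \<comment> \<open>A positive substitute for \<open>norm x\<close>, which may be 0;
      \<open>e\<close> is chosen so that \<open>a * e\<close> is half of \<eta>.\<close>
    define a where "a = norm x + 1"
    have a: "0 < a" "norm x \<le> a"
      by (simp_all add: a_def add_nonneg_pos)
    define e where "e = \<eta> / 2 / a"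
    have e: "0 < e"
      using \<eta> a by (simp add: e_def)
    obtain y where y: "y \<in> null_average x" and yz: "dist y z < e"
      using z e closure_approachable by blast
    have "norm x * norm (z - y) \<le> a * e"
      using yz a by (intro mult_mono) (auto simp: dist_norm norm_minus_commute)
    also have "\<dots> = \<eta> / 2"
      using a by (simp add: e_def)
    finally have le: "norm x * norm (z - y) \<le> \<eta> / 2" .
    have "\<forall>\<^sub>F \<alpha> in F. good \<alpha> \<and> (\<forall>h\<in>K.
        cmod (LINT g:right_translate (\<Lambda> \<alpha>) h|M. cinner x (U g y)) \<le> \<eta> / 2 * measure M (\<Lambda> \<alpha>))"
      using y \<eta> half_gt_zero unfolding null_average_def by blast
    then show "\<forall>\<^sub>F \<alpha> in F. good \<alpha> \<and> (\<forall>h\<in>K.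
        cmod (LINT g:right_translate (\<Lambda> \<alpha>) h|M. cinner x (U g z)) \<le> \<eta> * measure M (\<Lambda> \<alpha>))"
    proof eventually_elim
      case (elim \<alpha>)
      show ?case
      proof (intro conjI ballI)
        fix h assume h: "h \<in> K"
        let ?A = "right_translate (\<Lambda> \<alpha>) h"
        note A = good_translate[OF conjunct1[OF elim] h]
        have eq: "(LINT g:?A|M. cinner x (U g z)) =
            (LINT g:?A|M. cinner x (U g y)) + (LINT g:?A|M. cinner x (U g (z - y)))"
          using set_integral_U_add[OF A(1-3), of x y "z - y"] by simp
        have "cmod (LINT g:?A|M. cinner x (U g (z - y))) \<le> \<eta> / 2 * measure M (\<Lambda> \<alpha>)"
          using cmod_set_integral_U_le[OF A(1-3), of x "z - y"] mult_right_mono[OF le, of "measure M ?A"]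
          by (simp add: A(4))
        moreover have "cmod (LINT g:?A|M. cinner x (U g y)) \<le> \<eta> / 2 * measure M (\<Lambda> \<alpha>)"
          using elim h by blast
        ultimately show "cmod (LINT g:?A|M. cinner x (U g z)) \<le> \<eta> * measure M (\<Lambda> \<alpha>)"
          unfolding eq using norm_triangle_ineq[of "LINT g:?A|M. cinner x (U g y)"
              "LINT g:?A|M. cinner x (U g (z - y))"] by linarith
      qed (use elim in blast)
    qed
  qed
  then show ?thesis
    using closure_subset_eq by blast
qed

lemma diff_orth_proj_null_average: "y - orth_proj fixed_space y \<in> null_average x"
proof -
  define q where "q = y - orth_proj fixed_space y"
  obtain n where n: "n \<in> null_average x"
    and orth: "\<And>v. v \<in> null_average x \<Longrightarrow> Re (cinner v (q - n)) = 0"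
    using closed_subspace_orthogonal_decomposition[OF subspace_null_average closed_null_average]
    by blast
  define w where "w = q - n"
  \<comment> \<open>\<open>w\<close> is orthogonal, in real part, to the null-average space and in
    particular to its own coboundary \<open>w - U k w\<close>. Real parts are all that the
    fixed-vector criterion asks for.\<close>
  have "U k w = w" if "k \<in> K" for k
    using contraction_fixed_if_orthogonal[of "U k" w] norm_U_le[OF that]
      orth[OF coboundary_null_average[OF that]] unfolding w_def by blast
  then have "w \<in> fixed_space"
    by (simp add: fixed_space_def)
  \<comment> \<open>As a fixed vector, \<open>w\<close> is orthogonal to the projection residue
    \<open>q\<close>; it is also orthogonal in real part to \<open>n\<close>. Since
    \<open>w = q - n\<close>, it is orthogonal to itself.\<close>
  then have "cinner w q = 0"
    unfolding q_def
    by (intro orth_proj_props(2) subspace_fixed_space closed_fixed_space scaleC_fixed_space)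
  moreover have "Re (cinner w n) = 0"
    using orth[OF n] Re_cinner_commute by (metis w_def)
  ultimately have "(norm w)\<^sup>2 = 0"
    by (simp add: power2_norm_eq_cinner w_def cinner_diff_right)
  then have "q = n"
    by (simp add: w_def)
  then show ?thesis
    using n by (simp add: q_def)
qed

text \<open>A weak mean ergodic theorem, uniform over translates. Splitting \<open>y\<close> into
  its projection and the residue, the fixed part integrates exactly to the measure times
  \<open>cinner x (orth_proj fixed_space y)\<close>, and the residue has null averages.\<close>

lemma eventually_uniform_average:
  assumes "\<eta> > 0"
  shows "\<forall>\<^sub>F \<alpha> in F. good \<alpha> \<and> (\<forall>h\<in>K.
    cmod ((LINT g:right_translate (\<Lambda> \<alpha>) h|M. cinner x (U g y)) -
      complex_of_real (measure M (\<Lambda> \<alpha>)) * cinner x (orth_proj fixed_space y)) \<le> \<eta> * measure M (\<Lambda> \<alpha>))"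
proof -
  let ?p = "orth_proj fixed_space y"
  have p: "?p \<in> fixed_space"
    by (intro orth_proj_props(1) subspace_fixed_space closed_fixed_space scaleC_fixed_space)
  have "\<forall>\<^sub>F \<alpha> in F. good \<alpha> \<and> (\<forall>h\<in>K.
      cmod (LINT g:right_translate (\<Lambda> \<alpha>) h|M. cinner x (U g (y - ?p))) \<le> \<eta> * measure M (\<Lambda> \<alpha>))"
    using diff_orth_proj_null_average assms unfolding null_average_def by blast
  then show ?thesis
  proof eventually_elim
    case (elim \<alpha>)
    have "(LINT g:right_translate (\<Lambda> \<alpha>) h|M. cinner x (U g y)) -
        complex_of_real (measure M (\<Lambda> \<alpha>)) * cinner x ?p =
        (LINT g:right_translate (\<Lambda> \<alpha>) h|M. cinner x (U g (y - ?p)))" if "h \<in> K" for h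
      using set_integral_U_add[OF good_translate(1-3), of \<alpha> h x ?p "y - ?p"] elim that
        set_integral_fixed[OF good_translate(2) p, of \<alpha> h x] good_translate(4)[of \<alpha> h]
      by simp
    then show ?case
      using elim by auto
  qed
qed

end

section \<open>From uniform convergence of averages to a single index and a pointwise bound\<close>

theorem theorem2p1:
  fixes \<mu> :: "'g::{topological_group_add, t2_space} measure"
    and K :: "'g set"
    and U :: "'g \<Rightarrow> 'h::complex_hilbert \<Rightarrow> 'h"
    and V :: "'h set"
    and P :: "'h \<Rightarrow> 'h"
    and I :: "'i set" and le :: "'i \<Rightarrow> 'i \<Rightarrow> bool"
    and \<Lambda> :: "'i \<Rightarrow> 'g set"
    and x y :: 'h and \<epsilon> :: real
  assumes "locally_compact_space (euclidean :: 'g topology)"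
    and "right_haar_measure \<mu>"
    and "K \<in> sets borel" and "subsemigroup K"
    and "\<And>g h. g \<in> K \<Longrightarrow> h \<in> K \<Longrightarrow> g + h = h + g"
    and "\<And>g. g \<in> K \<Longrightarrow> bounded_clinear (U g)"
    and "\<And>g. g \<in> K \<Longrightarrow> onorm (U g) \<le> 1"
    and "\<And>g h. g \<in> K \<Longrightarrow> h \<in> K \<Longrightarrow> U g \<circ> U h = U (g + h)"
    and "\<And>u v. (\<lambda>g. cinner (U g u) v) \<in> borel_measurable (restrict_space borel K)"
    and "V = {v. \<forall>g\<in>K. U g v = v}"
    and "P = orth_proj V"
    and "directed_set I le"
    and "space_filling \<mu> K I le \<Lambda>"
    and "\<epsilon> > 0"
  shows "\<exists>\<alpha>\<^sub>0\<in>I. emeasure \<mu> (\<Lambda> \<alpha>\<^sub>0) > 0 \<and>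
     (\<forall>h\<in>K.
        cmod (complex_of_real (1 / measure \<mu> (\<Lambda> \<alpha>\<^sub>0)) *
              (LINT g:right_translate (\<Lambda> \<alpha>\<^sub>0) h|\<mu>. cinner x (U g y)))
          > cmod (cinner x (P y)) - \<epsilon>) \<and>
     (\<forall>h\<in>K. \<exists>g\<in>right_translate (\<Lambda> \<alpha>\<^sub>0) h.
        cmod (cinner x (U g y)) > cmod (cinner x (P y)) - \<epsilon>)"
proof -
  let ?F = "tails I le"
  have sf: "\<Lambda> \<alpha> \<in> sets borel" "\<Lambda> \<alpha> \<subseteq> K" "emeasure \<mu> (\<Lambda> \<alpha>) < \<infinity>" if "\<alpha> \<in> I" for \<alpha>
    using assms(13) that by (auto simp: space_filling_def)
  interpret contraction_semigroup_net \<mu> K U ?F \<Lambda>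
  proof unfold_locales
    show "U (g + h) z = U g (U h z)" if "g \<in> K" "h \<in> K" for g h z
      using assms(8)[OF that] by (metis comp_apply)
    show "\<forall>\<^sub>F \<alpha> in ?F. \<Lambda> \<alpha> \<in> sets borel \<and> \<Lambda> \<alpha> \<subseteq> K \<and> emeasure \<mu> (\<Lambda> \<alpha>) < \<infinity>"
      unfolding eventually_tails[OF assms(12)]
      using sf assms(12) unfolding directed_set_def by blast
    show "((\<lambda>\<alpha>. measure \<mu> (sym_diff (\<Lambda> \<alpha>) (right_translate (\<Lambda> \<alpha>) g)) / measure \<mu> (\<Lambda> \<alpha>)) \<longlongrightarrow> 0) ?F"
      if "g \<in> K" for g
    proof -
      have "A \<union> B - A \<inter> B = sym_diff A B" for A B :: "'g set"
        by blast
      then show ?thesis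
        using assms(13) that by (simp add: space_filling_def)
    qed
    show "\<forall>\<^sub>F \<alpha> in ?F. 0 < emeasure \<mu> (\<Lambda> \<alpha>)"
      using assms(13) by (simp add: space_filling_def)
    show "g + h \<in> K" if "g \<in> K" "h \<in> K" for g h
      using assms(4) that by (simp add: subsemigroup_def)
  qed (fact assms)+
  have P: "P y = orth_proj fixed_space y"
    unfolding assms(10,11) fixed_space_def ..
  let ?J = "\<lambda>\<alpha> h. LINT g:right_translate (\<Lambda> \<alpha>) h|\<mu>. cinner x (U g y)"
  \<comment> \<open>Half of \<epsilon> is used so that the non-strict bound later yields a strict
    one. By reflexivity of \<open>le\<close>, the starting point of the tail may itself serve as the
    index.\<close>
  obtain \<alpha> where \<alpha>: "\<alpha> \<in> I"
    and "good \<alpha> \<and> (\<forall>h\<in>K. cmod (?J \<alpha> h -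
      complex_of_real (measure \<mu> (\<Lambda> \<alpha>)) * cinner x (orth_proj fixed_space y)) \<le> \<epsilon> / 2 * measure \<mu> (\<Lambda> \<alpha>))"
  proof -
    have "\<exists>a\<in>I. \<forall>b\<in>I. le a b \<longrightarrow> good b \<and> (\<forall>h\<in>K. cmod (?J b h -
      complex_of_real (measure \<mu> (\<Lambda> b)) * cinner x (orth_proj fixed_space y)) \<le> \<epsilon> / 2 * measure \<mu> (\<Lambda> b))"
      using eventually_uniform_average[OF half_gt_zero[OF \<open>\<epsilon> > 0\<close>]]
      unfolding eventually_tails[OF assms(12)] .
    moreover have "\<forall>a\<in>I. le a a"
      using assms(12) unfolding directed_set_def by (elim conjE)
    ultimately show ?thesis
      using that by (elim bexE) (rule that, assumption, simp)
  qed
  then have good: "good \<alpha>"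
    and J: "\<And>h. h \<in> K \<Longrightarrow> cmod (?J \<alpha> h - complex_of_real (measure \<mu> (\<Lambda> \<alpha>)) * cinner x (P y))
        \<le> \<epsilon> / 2 * measure \<mu> (\<Lambda> \<alpha>)"
    unfolding P by simp_all
  let ?m = "measure \<mu> (\<Lambda> \<alpha>)"
  have m: "0 < ?m"
    using good by (rule measure_good)
  \<comment> \<open>Kept free of division: dividing by \<open>?m\<close> gives the claim on
    averages, while this form is contradicted directly in the pointwise claim.\<close>
  have J_gt: "(cmod (cinner x (P y)) - \<epsilon>) * ?m < cmod (?J \<alpha> h)" if "h \<in> K" for h
  proof -
    have "?m * cmod (cinner x (P y)) - cmod (?J \<alpha> h) \<le> \<epsilon> / 2 * ?m"
      using J[OF that] norm_triangle_ineq3[of "?J \<alpha> h" "complex_of_real ?m * cinner x (P y)"]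
      by (simp add: norm_mult)
    moreover have "\<epsilon> / 2 * ?m < \<epsilon> * ?m"
      using m \<open>\<epsilon> > 0\<close> by simp
    ultimately show ?thesis
      by (simp add: algebra_simps)
  qed
  have avg: "cmod (cinner x (P y)) - \<epsilon> < cmod (complex_of_real (1 / ?m) * ?J \<alpha> h)" if "h \<in> K" for h
    using J_gt[OF that] m by (simp add: norm_mult norm_divide pos_less_divide_eq)
  have pt: "\<exists>g\<in>right_translate (\<Lambda> \<alpha>) h. cmod (cinner x (P y)) - \<epsilon> < cmod (cinner x (U g y))"
    if h: "h \<in> K" for h
  proof (rule ccontr)
    let ?A = "right_translate (\<Lambda> \<alpha>) h"
    note A = good_translate[OF good h]
    assume "\<not> ?thesis"
    \<comment> \<open>If no point of the translate exceeded the threshold, integrating the pointwise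
      bound would keep the integral below the threshold times the measure, against
      \<open>J_gt\<close>.\<close>
    then have "cmod (cinner x (U g y)) \<le> cmod (cinner x (P y)) - \<epsilon>" if "g \<in> ?A" for g
      using that by (auto simp: not_less)
    then have "cmod (?J \<alpha> h) \<le> (cmod (cinner x (P y)) - \<epsilon>) * measure \<mu> ?A"
      using norm_set_integral_diff_le[of \<mu> ?A "\<lambda>g. cinner x (U g y)" "{}"]
        A(1,3) set_integrable_U[OF A(1-3)] right_haar_measureD(1)[OF assms(2)]
      by (auto simp: set_lebesgue_integral_def set_integrable_def)
    then show False
      using J_gt[OF h] by (simp add: A(4))
  qed
  show ?thesis
    using good avg pt by (intro bexI[OF _ \<alpha>] conjI ballI) (simp_all add: good_def)
qed

end
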